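(* For every integer $n\ge 6$, the symmetric group $S_n$ contains a cross-commuting nonabelian square.
   Context: A cross-commuting nonabelian square in a group is a quadruple $(F_0,F_1,G_0,G_1)$ of elements of the group such that $F_i$ commutes with $G_j$ for all $i,j\in\{0,1\}$, but $F_0$ and $F_1$ do not commute, and $G_0$ and $G_1$ do not commute. *)

theory Defs
  imports "HOL-Algebra.Sym_Groups"
begin

definition cross_commuting_nonabelian_square ::
    "('a, 'b) monoid_scheme \<Rightarrow> 'a \<times> 'a \<times> 'a \<times> 'a \<Rightarrow> bool" where
  "cross_commuting_nonabelian_square \<G> = (\<lambda>(F0, F1, G0, G1).
     {F0, F1, G0, G1} \<subseteq> carrier \<G> \<and>
     (\<forall>F\<in>{F0, F1}. \<forall>G\<in>{G0, G1}. F \<otimes>\<^bsub>\<G>\<^esub> G = G \<otimes>\<^bsub>\<G>\<^esub> F) \<and>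
     F0 \<otimes>\<^bsub>\<G>\<^esub> F1 \<noteq> F1 \<otimes>\<^bsub>\<G>\<^esub> F0 \<and>
     G0 \<otimes>\<^bsub>\<G>\<^esub> G1 \<noteq> G1 \<otimes>\<^bsub>\<G>\<^esub> G0)"

end

theory Submission
  imports Defs
begin

text \<open>Six points hold two disjoint triples, \<open>{1,2,3}\<close> and \<open>{4,5,6}\<close>,
  each carrying a nonabelian copy of S_3. Permutations with disjoint supports commute, which gives
  the cross relations; two transpositions sharing exactly one point do not, which gives a
  noncommuting pair in each copy.\<close>

lemma transpose_comp_commute_disjoint:
  assumes "{a, b} \<inter> {c, d} = {}"
  shows "transpose a b \<circ> transpose c d = transpose c d \<circ> transpose a b"
  using assms by (auto simp: fun_eq_iff transpose_def)

lemma transpose_comp_noncommute_overlap: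
  assumes "a \<noteq> b" "b \<noteq> c" "a \<noteq> c"
  shows "transpose a b \<circ> transpose b c \<noteq> transpose b c \<circ> transpose a b"
proof
  assume "transpose a b \<circ> transpose b c = transpose b c \<circ> transpose a b"
  \<comment> \<open>The point \<open>a\<close> separates the two products: the left one sends it to
    \<open>b\<close>, the right one to \<open>c\<close>.\<close>
  then have "(transpose a b \<circ> transpose b c) a = (transpose b c \<circ> transpose a b) a"
    by simp
  with assms show False
    by (simp add: transpose_def)
qed

theorem proposition6p1:
  fixes n :: nat
  assumes "n \<ge> 6"
  shows "\<exists>F0 F1 G0 G1. cross_commuting_nonabelian_square (sym_group n) (F0, F1, G0, G1)"
proof -
  \<comment> \<open>This puts the four witnesses in the carrier: they move only points up to 6, and
    \<open>n\<close> is at least 6.\<close>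
  have "transpose i j permutes {1..n}" if "i \<in> {1..6}" "j \<in> {1..6}" for i j :: nat
    using that assms by (intro permutes_swap_id) auto
  then have "cross_commuting_nonabelian_square (sym_group n)
    (transpose 1 2, transpose 2 3, transpose 4 5, transpose 5 6)"
    unfolding cross_commuting_nonabelian_square_def
    by (simp add: sym_group_def transpose_comp_commute_disjoint transpose_comp_noncommute_overlap
        del: One_nat_def)
  then show ?thesis by blast
qed

end
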